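(* Let $\mathcal R=(\mathbb R^2,\|\cdot\|_{\mathcal R})$ be a real Radon plane and let $\|(x,y)\|_2=\sqrt{|x|^2+|y|^2}$ be the Euclidean norm on $\mathbb R^2$. Then the following conditions are equivalent: (i) $\Gamma_0(\mathcal R)$ is isomorphic to $\Gamma_0(\mathbb R^2,\|\cdot\|_2)$. (ii) Both boundary points of each one-dimensional face in $\mathcal R$ are smooth.
   Context: For $x,y$ in a real normed space $\mathcal X$, $x\perp y$ (Birkhoff--James orthogonality) means $\|x+\lambda y\|\ge\|x\|$ for all $\lambda\in\mathbb R$. A Radon plane is a two-dimensional normed space in which $\perp$ is symmetric. $\Gamma_0(\mathcal X)$ is the directed graph whose vertices are all vectors of $\mathcal X$, with an edge $x\rightarrow y$ if and only if $x\perp y$; an isomorphism of digraphs is a bijection of vertices preserving edges in both directions. A nonzero vector $x$ is smooth if it has a unique supporting functional (a functional $f\in\mathcal X^*$ with $\|f\|=1$, $f(x)=\|x\|$). A face of the norm's unit ball is a convex subset $F$ of the unit sphere such that if $x,y$ are distinct normalized vectors whose open line segment intersects $F$, then $x,y\in F$. The dimension of a face is its real affine dimension; a one-dimensional face is a nondegenerate closed segment and its boundary points are its two endpoints. *)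

theory Defs
  imports
    "HOL-Analysis.Analysis"
    "Graph_Theory.Pair_Digraph"
    "Graph_Theory.Digraph_Isomorphism"
begin

text \<open>
  The norm of the plane is a variable of the problem, so it is an explicit function
  \<open>N\<close> on the vector space rather than the class operation \<open>norm\<close>,
  which on \<open>real^2\<close> is the Euclidean norm (lemma \<open>norm_real2\<close> below).
\<close>

definition is_norm :: "('a::real_vector \<Rightarrow> real) \<Rightarrow> bool" where
  "is_norm N \<longleftrightarrow>
     (\<forall>x. 0 \<le> N x) \<and>
     (\<forall>x. N x = 0 \<longleftrightarrow> x = 0) \<and>
     (\<forall>c x. N (c *\<^sub>R x) = \<bar>c\<bar> * N x) \<and>
     (\<forall>x y. N (x + y) \<le> N x + N y)"

definition BJ_orth :: "('a::real_vector \<Rightarrow> real) \<Rightarrow> 'a \<Rightarrow> 'a \<Rightarrow> bool" where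
  "BJ_orth N x y \<longleftrightarrow> (\<forall>c. N x \<le> N (x + c *\<^sub>R y))"

definition radon_plane :: "(real^2 \<Rightarrow> real) \<Rightarrow> bool" where
  "radon_plane N \<longleftrightarrow> is_norm N \<and> symp (BJ_orth N)"

definition Gamma0 :: "('a::real_vector \<Rightarrow> real) \<Rightarrow> 'a pair_pre_digraph" where
  "Gamma0 N = \<lparr>pverts = UNIV, parcs = {(x, y). BJ_orth N x y}\<rparr>"

definition dual_space :: "('a::real_vector \<Rightarrow> real) \<Rightarrow> ('a \<Rightarrow> real) set" where
  "dual_space N = {f. linear f \<and> (\<exists>K. \<forall>x. \<bar>f x\<bar> \<le> K * N x)}"

definition dual_norm :: "('a::real_vector \<Rightarrow> real) \<Rightarrow> ('a \<Rightarrow> real) \<Rightarrow> real" where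
  "dual_norm N f = (SUP x\<in>{x. N x \<le> 1}. \<bar>f x\<bar>)"

definition supporting_functional ::
    "('a::real_vector \<Rightarrow> real) \<Rightarrow> 'a \<Rightarrow> ('a \<Rightarrow> real) \<Rightarrow> bool" where
  "supporting_functional N x f \<longleftrightarrow> f \<in> dual_space N \<and> dual_norm N f = 1 \<and> f x = N x"

definition smooth_vector :: "('a::real_vector \<Rightarrow> real) \<Rightarrow> 'a \<Rightarrow> bool" where
  "smooth_vector N x \<longleftrightarrow> x \<noteq> 0 \<and> (\<exists>!f. supporting_functional N x f)"

definition unit_ball_face :: "('a::real_vector \<Rightarrow> real) \<Rightarrow> 'a set \<Rightarrow> bool" where
  "unit_ball_face N F \<longleftrightarrow>
     convex F \<and> F \<subseteq> {x. N x = 1} \<and>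
     (\<forall>x y. N x = 1 \<and> N y = 1 \<and> x \<noteq> y \<and> open_segment x y \<inter> F \<noteq> {} \<longrightarrow> x \<in> F \<and> y \<in> F)"

lemma norm_real2: "norm (v :: real^2) = sqrt (\<bar>v $ 1\<bar>\<^sup>2 + \<bar>v $ 2\<bar>\<^sup>2)"
  by (simp add: norm_vec_def L2_set_def UNIV_2)

text \<open>
  For the graphs \<open>Gamma0 N\<close>, the library's isomorphism of digraphs (with explicit
  arc maps) is a bijection of the vertices that preserves edges in both directions.
\<close>

lemma digraph_iso_Gamma0:
  fixes N :: "'a::real_vector \<Rightarrow> real" and M :: "'b::real_vector \<Rightarrow> real"
  shows "digraph_iso (with_proj (Gamma0 N)) (with_proj (Gamma0 M)) \<longleftrightarrow>
    (\<exists>\<phi>. bij \<phi> \<and> (\<forall>x y. BJ_orth N x y \<longleftrightarrow> BJ_orth M (\<phi> x) (\<phi> y)))"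
proof
  assume "digraph_iso (with_proj (Gamma0 N)) (with_proj (Gamma0 M))"
  then obtain f where f: "pre_digraph.digraph_isomorphism (with_proj (Gamma0 N)) f"
    and eq: "with_proj (Gamma0 M) = app_iso f (with_proj (Gamma0 N))"
    unfolding digraph_iso_def by blast
  let ?p = "iso_verts f"
  have t: "iso_tail f = fst" "iso_head f = snd"
    using eq by (simp_all add: app_iso_def with_proj_def)
  have inj: "inj ?p" and surj: "?p ` UNIV = UNIV"
    using f eq by (simp_all add: pre_digraph.digraph_isomorphism_def app_iso_def with_proj_def Gamma0_def)
  have arcs: "{(x, y). BJ_orth M x y} = iso_arcs f ` {(x, y). BJ_orth N x y}"
    using eq by (simp add: app_iso_def with_proj_def Gamma0_def)
  have a: "iso_arcs f (x, y) = (?p x, ?p y)" if "BJ_orth N x y" for x y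
    using f that
    by (auto simp: pre_digraph.digraph_isomorphism_def t with_proj_def Gamma0_def prod_eq_iff)
  have "BJ_orth N x y \<longleftrightarrow> BJ_orth M (?p x) (?p y)" for x y
  proof
    assume "BJ_orth N x y"
    then have "iso_arcs f (x, y) \<in> {(x, y). BJ_orth M x y}" unfolding arcs by blast
    with a[OF \<open>BJ_orth N x y\<close>] show "BJ_orth M (?p x) (?p y)" by simp
  next
    assume "BJ_orth M (?p x) (?p y)"
    then have "(?p x, ?p y) \<in> iso_arcs f ` {(x, y). BJ_orth N x y}" unfolding arcs[symmetric] by simp
    then obtain u v where uv: "BJ_orth N u v" "(?p x, ?p y) = iso_arcs f (u, v)" by auto
    then have "x = u" "y = v" using a[OF uv(1)] injD[OF inj] by auto
    with uv show "BJ_orth N x y" by simp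
  qed
  with inj surj show "\<exists>\<phi>. bij \<phi> \<and> (\<forall>x y. BJ_orth N x y \<longleftrightarrow> BJ_orth M (\<phi> x) (\<phi> y))"
    by (auto simp: bij_def)
next
  assume "\<exists>\<phi>. bij \<phi> \<and> (\<forall>x y. BJ_orth N x y \<longleftrightarrow> BJ_orth M (\<phi> x) (\<phi> y))"
  then obtain \<phi> where b: "bij \<phi>" and e: "\<And>x y. BJ_orth N x y \<longleftrightarrow> BJ_orth M (\<phi> x) (\<phi> y)" by blast
  let ?f = "\<lparr>iso_verts = \<phi>, iso_arcs = map_prod \<phi> \<phi>, iso_head = snd, iso_tail = fst\<rparr>"
  have "{(x, y). BJ_orth M x y} = map_prod \<phi> \<phi> ` {(x, y). BJ_orth N x y}"
  proof (intro set_eqI iffI)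
    fix p assume p: "p \<in> {(x, y). BJ_orth M x y}"
    obtain x y where "p = (\<phi> x, \<phi> y)" by (metis b bij_pointE surj_pair)
    with p e show "p \<in> map_prod \<phi> \<phi> ` {(x, y). BJ_orth N x y}" by force
  qed (use e in auto)
  then have "with_proj (Gamma0 M) = app_iso ?f (with_proj (Gamma0 N))"
    using b by (simp add: app_iso_def with_proj_def Gamma0_def bij_def)
  moreover have "pre_digraph.digraph_isomorphism (with_proj (Gamma0 N)) ?f"
    using bij_is_inj[OF b]
    by (auto simp: pre_digraph.digraph_isomorphism_def wf_digraph_def with_proj_def Gamma0_def
      inj_on_def)
  ultimately show "digraph_iso (with_proj (Gamma0 N)) (with_proj (Gamma0 M))"
    unfolding digraph_iso_def by blast
qed

text \<open>
  On a one-dimensional face, which is a nondegenerate closed segment, the boundary points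
  are taken relative to the affine hull; they are the two endpoints.
\<close>

lemma rel_frontier_closed_segment:
  fixes a b :: "'a::euclidean_space"
  assumes "a \<noteq> b"
  shows "rel_frontier (closed_segment a b) = {a, b}"
  using assms
  by (auto simp: rel_frontier_def rel_interior_closed_segment open_segment_def)

end

theory Submission
  imports Defs
begin

text \<open>
  In the Euclidean plane every path \<open>x \<bottom> y \<bottom> z \<bottom> w\<close> of nonzero vectors closes up to
  \<open>x \<bottom> w\<close>, and an isomorphism of the graphs transfers this path property, since \<open>0\<close> is the
  only vertex with a loop. For a Radon plane the property is equivalent to (ii): vectors
  \<open>x\<close> and \<open>z\<close> that are not parallel but share a neighbour \<open>y\<close> lie, up to scaling, on the
  face parallel to \<open>y\<close>; relative interior points of the face have no other neighbours than the
  multiples of \<open>y\<close>, and the same holds at an endpoint exactly if it is smooth.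

  Conversely, the path property says that the graph on the nonzero vectors is a disjoint union of
  complete bipartite graphs. All their sides have the cardinality of the continuum, and so has the
  set of components: the components meet the unit circle in the classes of a closed
  decomposition, so the quotient is a connected normal space with more than one point and
  Urysohn's lemma applies. Cardinality then determines the graph up to isomorphism.
\<close>

section \<open>Graphs that are disjoint unions of complete bipartite graphs\<close>

text \<open>\<open>path3\<close> shortens every walk of odd length to a single edge. Hence an odd
  closed walk would give a loop, so the graph is bipartite, and vertices in opposite parts of a
  component are adjacent.\<close>

locale biclique_graph =
  fixes R :: "'a \<Rightarrow> 'a \<Rightarrow> bool" and V :: "'a set"
  assumes sym: "R x y \<Longrightarrow> R y x"
    and dom: "R x y \<Longrightarrow> x \<in> V"
    and irrefl: "\<not> R x x"
    and path3: "R x y \<Longrightarrow> R y z \<Longrightarrow> R z w \<Longrightarrow> R x w"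
    and nbr_ex: "x \<in> V \<Longrightarrow> \<exists>y. R x y"
begin

text \<open>The part of the bipartition of its component that contains \<open>x\<close>: two steps
  already reach all of it.\<close>

definition side :: "'a \<Rightarrow> 'a set" where
  "side x = {z. \<exists>y. R x y \<and> R y z}"

definition comp :: "'a \<Rightarrow> 'a set" where
  "comp x = Collect (R x) \<union> side x"

text \<open>Two steps away from \<open>y\<close>, preceded by the edge from \<open>x\<close>, form a
  path of length three that closes up; conversely a neighbour of \<open>x\<close> is reached from
  \<open>y\<close> through \<open>x\<close>.\<close>

lemma side_eq_nbr: "R x y \<Longrightarrow> side y = Collect (R x)"
  unfolding side_def using sym path3 by blast

lemma comp_nbr: "R x y \<Longrightarrow> comp y = comp x"
  unfolding comp_def using side_eq_nbr sym by (metis Un_commute)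

lemma self_in_comp: "x \<in> V \<Longrightarrow> x \<in> comp x"
  unfolding comp_def side_def using nbr_ex sym by blast

lemma comp_subset: "comp x \<subseteq> V"
  unfolding comp_def side_def using sym dom by blast

lemma side_not_adjacent: "z \<in> side x \<Longrightarrow> \<not> R x z"
  unfolding side_def using sym path3 irrefl by blast

lemma comp_eq_iff:
  assumes "x \<in> V" "y \<in> V"
  shows "comp x = comp y \<longleftrightarrow> y \<in> comp x"
proof
  assume "y \<in> comp x"
  then consider "R x y" | u where "R x u" "R u y"
    unfolding comp_def side_def by blast
  then show "comp x = comp y"
    using comp_nbr by cases metis+
qed (use self_in_comp assms in blast)

lemma same_side_or_adjacent:
  assumes "R v w" "x \<in> comp v"
  shows "if R v x then side x = Collect (R v) else side x = side v \<and> R w x"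
proof (cases "R v x")
  case False
  then obtain u where u: "R v u" "R u x"
    using assms unfolding comp_def side_def by blast
  then have "R w x"
    using assms sym path3 by blast
  then show ?thesis
    using False side_eq_nbr assms sym by metis
qed (simp add: side_eq_nbr)

text \<open>Coordinates for the vertices: the component, the part inside it, and the position inside
  the part. The target does not depend on the graph, so any two such graphs can be compared through
  it.\<close>

lemma biclique_model:
  assumes nbr: "\<And>x. x \<in> V \<Longrightarrow> Collect (R x) \<approx> (UNIV :: real set)"
    and comps: "comp ` V \<approx> (UNIV :: real set)"
  obtains \<phi> :: "'a \<Rightarrow> real \<times> bool \<times> real"
  where "bij_betw \<phi> V UNIV"
    and "\<And>x y. x \<in> V \<Longrightarrow> y \<in> V \<Longrightarrow>
      R x y \<longleftrightarrow> fst (\<phi> x) = fst (\<phi> y) \<and> fst (snd (\<phi> x)) \<noteq> fst (snd (\<phi> y))"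
proof -
  obtain k where k: "bij_betw k (comp ` V) (UNIV :: real set)"
    using comps unfolding eqpoll_def by blast
  define rep where "rep c = (SOME v. v \<in> V \<and> comp v = c)" for c
  have rep: "rep (comp x) \<in> V \<and> comp (rep (comp x)) = comp x" if "x \<in> V" for x
    unfolding rep_def by (rule someI_ex) (use that in blast)
  \<comment> \<open>The chosen representative breaks the symmetry between the two parts of its
    component: \<open>b\<close> holds exactly on the part opposite to it.\<close>
  define b where "b x = R (rep (comp x)) x" for x
  \<comment> \<open>The bijection is chosen for the set and not for the vertex, so all vertices of
    one part are numbered consistently.\<close>
  define g where "g A = (SOME f. bij_betw f A (UNIV :: real set))" for A :: "'a set"
  have side_eqpoll: "side x \<approx> (UNIV :: real set)" if "x \<in> V" for x
    using nbr nbr_ex that side_eq_nbr sym dom by metis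
  have g: "bij_betw (g A) A (UNIV :: real set)" if "A \<approx> (UNIV :: real set)" for A
    unfolding g_def by (rule someI_ex[OF that[unfolded eqpoll_def]])
  have in_side: "x \<in> side x" if "x \<in> V" for x
    unfolding side_def using nbr_ex that sym by blast
  define \<phi> where "\<phi> x = (k (comp x), b x, g (side x) x)" for x
  have k_eq: "k (comp x) = k (comp y) \<longleftrightarrow> comp x = comp y" if "x \<in> V" "y \<in> V" for x y
    using inj_on_eq_iff[OF bij_betw_imp_inj_on[OF k]] that by blast
  have side_cases: "if b x then side x = Collect (R v) else side x = side v \<and> \<not> R v x"
    if x: "x \<in> V" and v: "v = rep (comp x)" for x v
  proof -
    obtain w where w: "R v w"
      using nbr_ex rep x v by blast
    have "x \<in> comp v"
      using rep x v self_in_comp by metis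
    then show ?thesis
      using same_side_or_adjacent[OF w] unfolding b_def v by metis
  qed
  have adj: "R x y \<longleftrightarrow> fst (\<phi> x) = fst (\<phi> y) \<and> fst (snd (\<phi> x)) \<noteq> fst (snd (\<phi> y))"
    if "x \<in> V" "y \<in> V" for x y
  proof
    assume xy: "R x y"
    then have c: "comp x = comp y"
      using comp_nbr by metis
    define v where "v = rep (comp x)"
    have v: "v = rep (comp y)"
      using c v_def by simp
    have "b x \<noteq> b y"
    proof
      assume "b x = b y"
      then have "side x = side y"
        using side_cases[OF that(1) v_def] side_cases[OF that(2) v] by (auto split: if_splits)
      then have "x \<in> side y"
        using in_side that by blast
      then have "R x x"
        using xy path3 sym unfolding side_def by blast
      then show False
        using irrefl by blast
    qed
    with c show "fst (\<phi> x) = fst (\<phi> y) \<and> fst (snd (\<phi> x)) \<noteq> fst (snd (\<phi> y))"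
      by (simp add: \<phi>_def)
  next
    assume "fst (\<phi> x) = fst (\<phi> y) \<and> fst (snd (\<phi> x)) \<noteq> fst (snd (\<phi> y))"
    then have c: "comp x = comp y" and b: "b x \<noteq> b y"
      using k_eq that by (auto simp: \<phi>_def)
    define v where "v = rep (comp x)"
    have v: "v = rep (comp y)"
      using c v_def by simp
    \<comment> \<open>\<open>p\<close> is a neighbour of \<open>v\<close>, and \<open>q\<close> is
      two steps away from \<open>v\<close>, so the path from \<open>p\<close> through
      \<open>v\<close> to \<open>q\<close> has length three.\<close>
    have *: "R p q" if "p \<in> V" "v = rep (comp p)" "q \<in> V" "v = rep (comp q)" "b p" "\<not> b q" for p q
    proof -
      have "R v p"
        using that b_def by simp
      moreover have "side q = side v"
        using side_cases that by metis
      ultimately show ?thesis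
        using in_side[of q] that sym path3 unfolding side_def by blast
    qed
    show "R x y"
      using *[of x y] *[of y x] that b v v_def sym by blast
  qed
  have "bij_betw \<phi> V UNIV"
    unfolding bij_betw_def
  proof
    show "inj_on \<phi> V"
    proof (rule inj_onI)
      fix x y assume xy: "x \<in> V" "y \<in> V" "\<phi> x = \<phi> y"
      then have "comp x = comp y" "b x = b y" and geq: "g (side x) x = g (side y) y"
        using k_eq by (auto simp: \<phi>_def)
      then have "side x = side y"
        using side_cases[OF xy(1) refl] side_cases[OF xy(2) refl] by (auto split: if_splits)
      then show "x = y"
        using geq in_side xy g[OF side_eqpoll] by (metis bij_betw_imp_inj_on inj_on_eq_iff)
    qed
    have "\<exists>x\<in>V. \<phi> x = (c, s, r)" for c s r
    proof -
      obtain u where u: "u \<in> V" "k (comp u) = c"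
        using k by (metis (no_types, lifting) UNIV_I bij_betw_imp_surj_on imageE)
      define v where "v = rep (comp u)"
      have v: "v \<in> V" "comp v = comp u"
        using rep u v_def by auto
      define A where "A = (if s then Collect (R v) else side v)"
      have "A \<approx> (UNIV :: real set)"
        using nbr side_eqpoll v A_def by simp
      then obtain x where x: "x \<in> A" "g A x = r"
        using g by (metis UNIV_I bij_betw_imp_surj_on imageE)
      have "x \<in> comp v"
        using x(1) unfolding A_def comp_def by (auto split: if_splits)
      then have "x \<in> V"
        using comp_subset by blast
      have c: "comp x = comp u"
        using comp_eq_iff[OF v(1) \<open>x \<in> V\<close>] \<open>x \<in> comp v\<close> v(2) by simp
      have "R v x \<longleftrightarrow> s"
        using x(1) side_not_adjacent unfolding A_def by (auto split: if_splits)
      then have "b x \<longleftrightarrow> s"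
        using c v_def b_def by simp
      moreover have "side x = A"
        using side_cases[OF \<open>x \<in> V\<close>, of v] calculation c v_def A_def by (auto split: if_splits)
      ultimately have "\<phi> x = (c, s, r)"
        using x c u by (simp add: \<phi>_def)
      with \<open>x \<in> V\<close> show ?thesis
        by blast
    qed
    then show "\<phi> ` V = UNIV"
      by (metis (no_types, lifting) UNIV_eq_I image_eqI prod_cases3)
  qed
  with adj show ?thesis
    using that by blast
qed

end

section \<open>Quotients of continua\<close>

text \<open>By \<open>sat\<close>, saturations of closed sets are closed, which makes
  \<open>q\<close> a closed map onto the quotient; so the quotient inherits normality and T1 from
  the compact set. It is also connected, and a Urysohn function separating two of its points takes
  every value of an interval.\<close>

lemma continuum_quotient_reals_lepoll:
  fixes S :: "'a::euclidean_space set" and q :: "'a \<Rightarrow> 'b"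
  assumes "compact S" "Topological_Spaces.connected S"
    and sat: "\<And>C. closed C \<Longrightarrow> C \<subseteq> S \<Longrightarrow> closed {x \<in> S. q x \<in> q ` C}"
    and nonconst: "x \<in> S" "y \<in> S" "q x \<noteq> q y"
  shows "(UNIV :: real set) \<lesssim> q ` S"
proof -
  let ?X = "top_of_set S"
  \<comment> \<open>The open sets of the quotient topology on the image of \<open>S\<close>.\<close>
  define op where "op U \<longleftrightarrow> U \<subseteq> q ` S \<and> openin ?X {x \<in> S. q x \<in> U}" for U
  have "istopology op"
    unfolding istopology_def
  proof (intro conjI allI impI)
    fix U W assume "op U" "op W"
    moreover have "{x \<in> S. q x \<in> U \<inter> W} = {x \<in> S. q x \<in> U} \<inter> {x \<in> S. q x \<in> W}"
      by blast
    ultimately show "op (U \<inter> W)"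
      unfolding op_def by auto
  next
    fix K assume K: "\<forall>U\<in>K. op U"
    moreover have "{x \<in> S. q x \<in> \<Union>K} = (\<Union>U\<in>K. {x \<in> S. q x \<in> U})"
      by blast
    ultimately show "op (\<Union>K)"
      unfolding op_def by auto
  qed
  then have openin_Y: "openin (topology op) U \<longleftrightarrow> op U" for U
    by (simp add: topology_inverse')
  let ?Y = "topology op"
  have "op (q ` S)"
  proof -
    have "{x \<in> S. q x \<in> q ` S} = S"
      by blast
    then show ?thesis
      by (simp add: op_def)
  qed
  then have top_Y: "topspace ?Y = q ` S"
    by (intro equalityI openin_subset) (auto simp: topspace_def openin_Y op_def)
  have quot: "quotient_map ?X ?Y q"
    unfolding quotient_map_def using top_Y openin_Y op_def by auto
  have clos: "closed_map ?X ?Y q"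
    unfolding closed_map_def
  proof (intro allI impI)
    fix C assume "closedin ?X C"
    then have "closed C" "C \<subseteq> S"
      using \<open>compact S\<close> by (auto simp: closedin_closed_eq compact_imp_closed)
    then have "closed {x \<in> S. q x \<in> q ` C}"
      by (rule sat)
    then have "closedin ?X {x \<in> S. q x \<in> q ` C}"
      by (auto intro: closed_subset)
    then show "closedin ?Y (q ` C)"
      using quot \<open>C \<subseteq> S\<close> unfolding quotient_map_closedin by (simp add: top_Y image_mono)
  qed
  have "normal_space ?X"
    using \<open>compact S\<close>
    by (intro compact_Hausdorff_or_regular_imp_normal_space)
       (auto simp: compact_space_subtopology Hausdorff_space_subtopology)
  then have "normal_space ?Y"
    using normal_space_continuous_closed_map_image quotient_imp_continuous_map[OF quot] clos top_Y
    by (metis quot quotient_imp_surjective_map)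
  moreover have "t1_space ?Y"
    using t1_space_closed_map_image[OF clos] quotient_imp_surjective_map[OF quot]
    by (simp add: Hausdorff_imp_t1_space Hausdorff_space_subtopology)
  moreover have "connected_space ?Y"
    using connected_space_quotient_map_image[OF quot] \<open>Topological_Spaces.connected S\<close>
    by (simp add: connected_space_subtopology)
  ultimately have "(UNIV :: real set) \<lesssim> topspace ?Y"
    using nonconst by (intro connected_space_imp_card_ge) (auto simp: top_Y)
  then show ?thesis
    by (simp add: top_Y)
qed

lemma real2_lepoll_reals: "(A :: (real^2) set) \<lesssim> (UNIV :: real set)"
proof -
  have "(UNIV :: real set) \<times> (UNIV :: real set) \<approx> (UNIV :: real set)"
    unfolding eqpoll_iff_card_of_ordIso
    by (rule card_of_Times_same_infinite) (rule infinite_UNIV_char_0)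
  moreover have "A \<lesssim> (UNIV :: real set) \<times> (UNIV :: real set)"
    unfolding lepoll_def
    by (rule exI[of _ "\<lambda>v. (v $ 1, v $ 2)"]) (auto simp: inj_on_def vec_eq_iff forall_2)
  ultimately show ?thesis
    using lepoll_trans2 by blast
qed

section \<open>Birkhoff--James orthogonality in a normed plane\<close>

text \<open>For nonzero \<open>y\<close> the functionals vanishing on \<open>y\<close> are the
  multiples of \<open>\<lambda>v. det2 v y\<close>. This turns orthogonality to \<open>y\<close> and
  supporting functionals into inequalities between determinants.\<close>

definition det2 :: "real^2 \<Rightarrow> real^2 \<Rightarrow> real" where
  "det2 u v = u $ 1 * v $ 2 - u $ 2 * v $ 1"

lemma det2_add [simp]: "det2 (u + v) w = det2 u w + det2 v w" "det2 w (u + v) = det2 w u + det2 w v"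
  by (simp_all add: det2_def algebra_simps)

lemma det2_diff [simp]: "det2 (u - v) w = det2 u w - det2 v w" "det2 w (u - v) = det2 w u - det2 w v"
  by (simp_all add: det2_def algebra_simps)

lemma det2_scaleR [simp]: "det2 (c *\<^sub>R u) w = c * det2 u w" "det2 w (c *\<^sub>R u) = c * det2 w u"
  by (simp_all add: det2_def algebra_simps)

lemma det2_self [simp]: "det2 u u = 0"
  by (simp add: det2_def)

lemma det2_commute: "det2 u v = - det2 v u"
  by (simp add: det2_def)

lemma det2_eq_0_imp_scaleR:
  assumes "det2 u v = 0" "v \<noteq> 0"
  obtains c where "u = c *\<^sub>R v"
proof (cases "v $ 1 = 0")
  case True
  then have "v $ 2 \<noteq> 0"
    using assms(2) by (auto simp: vec_eq_iff forall_2)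
  with True assms(1) have "u = (u $ 2 / v $ 2) *\<^sub>R v"
    by (auto simp: vec_eq_iff forall_2 det2_def)
  then show ?thesis
    by (rule that)
next
  case False
  with assms(1) have "u = (u $ 1 / v $ 1) *\<^sub>R v"
    by (auto simp: vec_eq_iff forall_2 det2_def field_simps)
  then show ?thesis
    by (rule that)
qed

lemma det2_0_trans:
  assumes "det2 u v = 0" "det2 v w = 0" "v \<noteq> 0"
  shows "det2 u w = 0"
  using det2_eq_0_imp_scaleR[OF assms(1,3)] assms(2) by (metis det2_scaleR(1) mult_zero_right)

lemma det2_cramer: "det2 x y *\<^sub>R z = det2 z y *\<^sub>R x + det2 x z *\<^sub>R y"
  by (simp add: det2_def vec_eq_iff forall_2 algebra_simps)

lemma linear_eq_det2:
  assumes "linear (f :: real^2 \<Rightarrow> real)"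
  obtains w where "f = (\<lambda>v. det2 v w)"
proof -
  let ?w = "vector [- f (axis 2 1), f (axis 1 1)] :: real^2"
  have "f v = det2 v ?w" for v
  proof -
    have "v = v $ 1 *\<^sub>R axis 1 1 + v $ 2 *\<^sub>R axis 2 1"
      by (simp add: vec_eq_iff forall_2 axis_def)
    then have "f v = v $ 1 * f (axis 1 1) + v $ 2 * f (axis 2 1)"
      using linear_add[OF assms] linear_scale[OF assms] by (metis real_scaleR_def)
    then show ?thesis
      by (simp add: det2_def)
  qed
  then show ?thesis
    using that by blast
qed

section \<open>Norms on the plane and the topology of the unit circle\<close>

locale normed_plane =
  fixes N :: "real^2 \<Rightarrow> real"
  assumes is_norm: "is_norm N"
begin

lemma N_nonneg [simp]: "0 \<le> N x"
  and N_eq_0 [simp]: "N x = 0 \<longleftrightarrow> x = 0"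
  and N_scaleR [simp]: "N (c *\<^sub>R x) = \<bar>c\<bar> * N x"
  and N_triangle: "N (x + y) \<le> N x + N y"
  using is_norm unfolding is_norm_def by blast+

lemma N_0 [simp]: "N 0 = 0"
  by simp

lemma N_pos [simp]: "0 < N x \<longleftrightarrow> x \<noteq> 0"
  by (metis N_eq_0 N_nonneg less_eq_real_def less_irrefl)

lemma convex_N: "convex_on A N" if "convex A"
proof (rule convex_onI[OF _ that])
  fix t :: real and x y assume "0 < t" "t < 1"
  then show "N ((1 - t) *\<^sub>R x + t *\<^sub>R y) \<le> (1 - t) * N x + t * N y"
    using N_triangle[of "(1 - t) *\<^sub>R x" "t *\<^sub>R y"] by simp
qed

lemma continuous_N: "continuous_on UNIV N"
  by (rule convex_on_continuous) (auto intro: convex_N)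

lemma continuous_on_N [continuous_intros]: "continuous_on A f \<Longrightarrow> continuous_on A (\<lambda>x. N (f x))"
  using continuous_on_compose2[OF continuous_N] by blast

definition unit_circle :: "(real^2) set" where
  "unit_circle = {x. N x = 1}"

lemma closed_unit_circle: "closed unit_circle"
  unfolding unit_circle_def by (intro closed_Collect_eq continuous_intros)

text \<open>The minimum of \<open>N\<close> on the Euclidean unit sphere is positive; by homogeneity
  its reciprocal bounds the unit circle of \<open>N\<close> in the Euclidean norm.\<close>

lemma compact_unit_circle: "compact unit_circle"
proof -
  have "compact (sphere (0::real^2) 1)" "sphere (0::real^2) 1 \<noteq> {}"
    by auto
  then obtain u where u: "u \<in> sphere 0 1" "\<And>v. v \<in> sphere 0 1 \<Longrightarrow> N u \<le> N v"
    using continuous_attains_inf[of "sphere 0 1" N] continuous_on_subset[OF continuous_N] by blast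
  have "N u > 0"
    using u by auto
  have "norm x \<le> 1 / N u" if "x \<in> unit_circle" for x
  proof -
    have "x \<noteq> 0" and x: "N x = 1"
      using that unfolding unit_circle_def by auto
    then have "N u \<le> N (x /\<^sub>R norm x)"
      by (intro u) simp
    then show ?thesis
      using \<open>x \<noteq> 0\<close> x \<open>N u > 0\<close> by (simp add: field_simps)
  qed
  then show ?thesis
    using closed_unit_circle by (auto simp: compact_eq_bounded_closed bounded_iff)
qed

text \<open>Radial projection maps the connected punctured plane continuously onto the unit
  circle.\<close>

lemma connected_unit_circle: "Topological_Spaces.connected unit_circle"
proof -
  have "unit_circle = (\<lambda>x. x /\<^sub>R N x) ` (- {0})"
  proof (intro set_eqI iffI)
    fix x assume "x \<in> unit_circle"
    then have "x = x /\<^sub>R N x" "x \<in> - {0}"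
      unfolding unit_circle_def by auto
    then show "x \<in> (\<lambda>x. x /\<^sub>R N x) ` (- {0})"
      by blast
  next
    fix x assume "x \<in> (\<lambda>x. x /\<^sub>R N x) ` (- {0})"
    then obtain u where "u \<noteq> 0" "x = u /\<^sub>R N u"
      by blast
    then show "x \<in> unit_circle"
      using left_inverse[of "N u"] by (simp add: unit_circle_def)
  qed
  moreover have "Topological_Spaces.connected ((\<lambda>x. x /\<^sub>R N x) ` (- {0}))"
    by (intro connected_continuous_image continuous_intros connected_punctured_universe) auto
  ultimately show ?thesis
    by simp
qed

section \<open>Orthogonality in terms of determinants\<close>

lemma BJ_orth_scaleR:
  assumes "BJ_orth N x y"
  shows "BJ_orth N (a *\<^sub>R x) (b *\<^sub>R y)"
proof (cases "a = 0")
  case False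
  have "N (a *\<^sub>R x) \<le> N (a *\<^sub>R x + c *\<^sub>R b *\<^sub>R y)" for c
  proof -
    have "a *\<^sub>R x + c *\<^sub>R b *\<^sub>R y = a *\<^sub>R (x + (c * b / a) *\<^sub>R y)"
      using False by (simp add: algebra_simps)
    moreover have "N x \<le> N (x + (c * b / a) *\<^sub>R y)"
      using assms unfolding BJ_orth_def by blast
    ultimately show ?thesis
      by (metis N_scaleR abs_ge_zero mult_left_mono)
  qed
  then show ?thesis
    unfolding BJ_orth_def by blast
qed (simp add: BJ_orth_def)

lemma BJ_orth_self_iff: "BJ_orth N x x \<longleftrightarrow> x = 0"
proof
  assume "BJ_orth N x x"
  then have "N x \<le> N (x + (-1) *\<^sub>R x)"
    unfolding BJ_orth_def by blast
  moreover have "x + (-1) *\<^sub>R x = 0"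
    by simp
  ultimately have "N x \<le> N 0"
    by metis
  then show "x = 0"
    using N_pos[of x] by (simp del: N_pos add: not_less[symmetric])
qed (simp add: BJ_orth_def)

text \<open>The functional \<open>\<lambda>z. det2 z y\<close> is constant on the line through
  \<open>x\<close> in direction \<open>y\<close>. This line avoids the open ball of radius
  \<open>N x\<close> exactly when the functional attains its dual norm in the direction of
  \<open>x\<close>.\<close>

lemma BJ_orth_iff_det2:
  assumes "y \<noteq> 0"
  shows "BJ_orth N x y \<longleftrightarrow> (\<forall>z. N x * \<bar>det2 z y\<bar> \<le> N z * \<bar>det2 x y\<bar>)"
proof
  assume xy: "BJ_orth N x y"
  show "\<forall>z. N x * \<bar>det2 z y\<bar> \<le> N z * \<bar>det2 x y\<bar>"
  proof
    fix z
    \<comment> \<open>By Cramer's rule \<open>det2 x y *\<^sub>R z\<close> differs from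
      \<open>det2 z y *\<^sub>R x\<close> by a multiple of \<open>y\<close>.\<close>
    have "N (det2 z y *\<^sub>R x) \<le> N (det2 z y *\<^sub>R x + 1 *\<^sub>R det2 x z *\<^sub>R y)"
      using BJ_orth_scaleR[OF xy] unfolding BJ_orth_def by blast
    also have "\<dots> = N (det2 x y *\<^sub>R z)"
      by (subst det2_cramer[of x y z]) (simp only: scaleR_one)
    finally show "N x * \<bar>det2 z y\<bar> \<le> N z * \<bar>det2 x y\<bar>"
      by (simp add: mult.commute)
  qed
next
  assume *: "\<forall>z. N x * \<bar>det2 z y\<bar> \<le> N z * \<bar>det2 x y\<bar>"
  show "BJ_orth N x y"
  proof (cases "det2 x y = 0")
    case True
    \<comment> \<open>All right-hand sides vanish here, while \<open>y\<close> turned by a right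
      angle has nonzero determinant with \<open>y\<close>; this forces \<open>x = 0\<close>.\<close>
    let ?z = "vector [y $ 2, - y $ 1] :: real^2"
    have "det2 ?z y = (y $ 1)\<^sup>2 + (y $ 2)\<^sup>2"
      by (simp add: det2_def power2_eq_square)
    then have "det2 ?z y \<noteq> 0"
      using assms by (auto simp: vec_eq_iff forall_2 sum_power2_eq_zero_iff)
    moreover have "N x * \<bar>det2 ?z y\<bar> \<le> 0"
      using * True by (metis abs_zero mult_zero_right)
    ultimately have "N x \<le> 0"
      by (simp add: mult_le_0_iff)
    then have "x = 0"
      using N_pos[of x] by linarith
    then show ?thesis
      by (simp add: BJ_orth_def)
  next
    case False
    have "N x * \<bar>det2 x y\<bar> \<le> N (x + c *\<^sub>R y) * \<bar>det2 x y\<bar>" for c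
      using *[rule_format, of "x + c *\<^sub>R y"] by simp
    then show ?thesis
      using False unfolding BJ_orth_def by simp
  qed
qed

lemma BJ_orth_det2_nonzero:
  assumes "BJ_orth N x y" "x \<noteq> 0" "y \<noteq> 0"
  shows "det2 x y \<noteq> 0"
proof
  assume "det2 x y = 0"
  then obtain c where c: "x = c *\<^sub>R y"
    using det2_eq_0_imp_scaleR assms by blast
  then have "BJ_orth N (1 *\<^sub>R x) (c *\<^sub>R y)"
    using assms BJ_orth_scaleR by blast
  then show False
    using c assms BJ_orth_self_iff by simp
qed

text \<open>A line separating \<open>x\<close> from the open ball of radius \<open>N x\<close>
  supports that ball at \<open>x\<close>; its direction is the required \<open>y\<close>.\<close>

lemma BJ_orth_exists: "\<exists>y. y \<noteq> 0 \<and> BJ_orth N x y"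
proof (cases "x = 0")
  case True
  have "axis 1 1 \<noteq> (0 :: real^2)"
    by (simp add: axis_eq_0_iff)
  moreover have "BJ_orth N x (axis 1 1)"
    using True by (simp add: BJ_orth_def)
  ultimately show ?thesis
    by blast
next
  case False
  define B where "B = {v. N v < N x}"
  have "convex B"
    unfolding B_def convex_def
  proof clarify
    fix v w :: "real^2" and s t :: real
    assume vw: "N v < N x" "N w < N x" and st: "0 \<le> s" "0 \<le> t" "s + t = 1"
    have "N (s *\<^sub>R v + t *\<^sub>R w) \<le> s * N v + t * N w"
      using N_triangle[of "s *\<^sub>R v" "t *\<^sub>R w"] st by simp
    also have "\<dots> < N x"
      using convex_bound_lt[OF vw st] .
    finally show "N (s *\<^sub>R v + t *\<^sub>R w) < N x" .
  qed
  moreover have "open B"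
    unfolding B_def by (intro open_Collect_less continuous_intros)
  moreover have "0 \<in> B"
    using False by (simp add: B_def)
  ultimately obtain a b where a: "a \<noteq> 0" "\<forall>v\<in>B. a \<bullet> v \<le> b" "b \<le> a \<bullet> x"
    using separating_hyperplane_sets[of B "{x}"] by (auto simp: B_def)
  let ?y = "vector [- a $ 2, a $ 1] :: real^2"
  have det: "det2 v ?y = a \<bullet> v" for v
    by (simp add: det2_def inner_vec_def sum_2 mult.commute)
  have "N x \<le> N (x + c *\<^sub>R ?y)" for c
  proof (rule ccontr)
    assume "\<not> N x \<le> N (x + c *\<^sub>R ?y)"
    then have "x + c *\<^sub>R ?y \<in> B"
      by (simp add: B_def)
    then obtain e where e: "e > 0" "ball (x + c *\<^sub>R ?y) e \<subseteq> B"
      using \<open>open B\<close> open_contains_ball by blast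
    define d where "d = e / 2 / norm a"
    \<comment> \<open>The separation is only weak, but \<open>B\<close> is open: moving by
      \<open>e / 2\<close> along the normal \<open>a\<close> stays in \<open>B\<close> and pushes
      the functional strictly beyond its value at \<open>x\<close>.\<close>
    have "x + c *\<^sub>R ?y + d *\<^sub>R a \<in> B"
      using e a by (intro subsetD[OF e(2)]) (simp add: dist_norm d_def)
    then have "a \<bullet> (x + c *\<^sub>R ?y + d *\<^sub>R a) \<le> a \<bullet> x"
      using a by force
    moreover have "a \<bullet> ?y = 0"
      using det[of ?y] by simp
    ultimately have "d * (a \<bullet> a) \<le> 0"
      by (simp add: inner_add_right)
    moreover have "d > 0" "a \<bullet> a > 0"
      using e a by (auto simp: d_def)
    ultimately show False
      by (simp add: mult_le_0_iff)
  qed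
  then have "BJ_orth N x ?y"
    unfolding BJ_orth_def by blast
  moreover have "?y \<noteq> 0"
    using a(1) det[of a] by (metis det2_def inner_eq_zero_iff diff_0 minus_zero mult_zero_right zero_index)
  ultimately show ?thesis
    by blast
qed

section \<open>Supporting functionals and smoothness\<close>

lemma supporting_functional_iff:
  assumes "x \<noteq> 0"
  shows "supporting_functional N x f \<longleftrightarrow> linear f \<and> (\<forall>z. \<bar>f z\<bar> \<le> N z) \<and> f x = N x"
proof
  assume f: "supporting_functional N x f"
  then obtain K where lin: "linear f" and K: "\<And>z. \<bar>f z\<bar> \<le> K * N z"
    and norm1: "(SUP z\<in>{z. N z \<le> 1}. \<bar>f z\<bar>) = 1" and fx: "f x = N x"
    unfolding supporting_functional_def dual_space_def dual_norm_def by blast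
  have "\<bar>f z\<bar> \<le> \<bar>K\<bar>" if "N z \<le> 1" for z
  proof -
    have "K * N z \<le> \<bar>K\<bar> * 1"
      using that by (intro mult_mono) auto
    then show ?thesis
      using K[of z] by linarith
  qed
  \<comment> \<open>A real supremum is an upper bound only for a set bounded above; membership in
    \<open>dual_space\<close> supplies this bound.\<close>
  then have bdd: "bdd_above ((\<lambda>z. \<bar>f z\<bar>) ` {z. N z \<le> 1})"
    by (auto intro!: bdd_aboveI2)
  have "\<bar>f z\<bar> \<le> N z" for z
  proof (cases "z = 0")
    case True
    then show ?thesis
      using K[of z] by simp
  next
    case False
    then have "\<bar>f (z /\<^sub>R N z)\<bar> \<le> (SUP z\<in>{z. N z \<le> 1}. \<bar>f z\<bar>)"
      by (intro cSUP_upper bdd) simp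
    then have "\<bar>f (z /\<^sub>R N z)\<bar> \<le> 1"
      unfolding norm1 .
    then show ?thesis
      using False by (simp add: linear_scale[OF lin] abs_mult field_simps)
  qed
  with lin fx show "linear f \<and> (\<forall>z. \<bar>f z\<bar> \<le> N z) \<and> f x = N x"
    by blast
next
  assume f: "linear f \<and> (\<forall>z. \<bar>f z\<bar> \<le> N z) \<and> f x = N x"
  have "f (x /\<^sub>R N x) = 1"
    using f assms by (simp add: linear_scale)
  have "(SUP z\<in>{z. N z \<le> 1}. \<bar>f z\<bar>) = 1"
  proof (rule cSup_eq_maximum)
    show "1 \<in> (\<lambda>z. \<bar>f z\<bar>) ` {z. N z \<le> 1}"
      using \<open>f (x /\<^sub>R N x) = 1\<close> assms by (intro image_eqI[of _ _ "x /\<^sub>R N x"]) auto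
  qed (use f in \<open>auto intro: order_trans\<close>)
  moreover have "f \<in> dual_space N"
    unfolding dual_space_def using f by (auto intro!: exI[of _ 1])
  ultimately show "supporting_functional N x f"
    using f unfolding supporting_functional_def dual_norm_def by blast
qed

lemma supporting_functional_det2:
  assumes "x \<noteq> 0" "y \<noteq> 0" "BJ_orth N x y"
  shows "supporting_functional N x (\<lambda>z. N x / det2 x y * det2 z y)"
proof -
  have d: "det2 x y \<noteq> 0"
    using BJ_orth_det2_nonzero assms by blast
  have "linear (\<lambda>z. N x / det2 x y * det2 z y)"
    by (rule linearI) (auto simp: algebra_simps)
  moreover have "\<bar>N x / det2 x y * det2 z y\<bar> \<le> N z" for z
    using assms(3) d unfolding BJ_orth_iff_det2[OF assms(2)] by (simp add: abs_mult field_simps)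
  ultimately show ?thesis
    using d by (simp add: supporting_functional_iff[OF assms(1)])
qed

lemma supporting_functional_obtain_det2:
  assumes "x \<noteq> 0" "supporting_functional N x f"
  obtains y where "f = (\<lambda>v. det2 v y)" "y \<noteq> 0" "BJ_orth N x y"
proof -
  have f: "linear f" "\<And>z. \<bar>f z\<bar> \<le> N z" "f x = N x"
    using assms supporting_functional_iff by blast+
  obtain y where y: "f = (\<lambda>v. det2 v y)"
    using linear_eq_det2[OF f(1)] .
  have "N x \<le> N (x + c *\<^sub>R y)" for c
    using f(2)[of "x + c *\<^sub>R y"] f(3) y by simp
  then have "BJ_orth N x y"
    unfolding BJ_orth_def by blast
  moreover have "y \<noteq> 0"
    using f(3) y assms(1) by (auto simp: det2_def)
  ultimately show ?thesis
    using that y by blast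
qed

text \<open>For nonzero \<open>x\<close>, a supporting functional at \<open>x\<close> is determined
  by its kernel, since its value at \<open>x\<close> fixes the scalar. The kernels that occur are
  the lines spanned by the nonzero \<open>y\<close> to which \<open>x\<close> is orthogonal.\<close>

lemma smooth_vector_iff:
  "smooth_vector N x \<longleftrightarrow> x \<noteq> 0 \<and>
    (\<forall>y z. y \<noteq> 0 \<longrightarrow> z \<noteq> 0 \<longrightarrow> BJ_orth N x y \<longrightarrow> BJ_orth N x z \<longrightarrow> det2 y z = 0)"
proof (intro iffI conjI allI impI)
  fix y z
  assume s: "smooth_vector N x" and yz: "y \<noteq> 0" "z \<noteq> 0" "BJ_orth N x y" "BJ_orth N x z"
  then have x: "x \<noteq> 0"
    by (simp add: smooth_vector_def)
  then have "(\<lambda>v. N x / det2 x y * det2 v y) = (\<lambda>v. N x / det2 x z * det2 v z)"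
    using s yz supporting_functional_det2 unfolding smooth_vector_def by blast
  then have "N x / det2 x z * det2 y z = N x / det2 x y * det2 y y"
    by metis
  then show "det2 y z = 0"
    using x yz BJ_orth_det2_nonzero by simp
next
  assume *: "x \<noteq> 0 \<and>
    (\<forall>y z. y \<noteq> 0 \<longrightarrow> z \<noteq> 0 \<longrightarrow> BJ_orth N x y \<longrightarrow> BJ_orth N x z \<longrightarrow> det2 y z = 0)"
  obtain y where "y \<noteq> 0" "BJ_orth N x y"
    using BJ_orth_exists by blast
  then have ex: "\<exists>f. supporting_functional N x f"
    using * supporting_functional_det2 by blast
  have "f = g" if f: "supporting_functional N x f" and g: "supporting_functional N x g" for f g
  proof -
    obtain y where y: "f = (\<lambda>v. det2 v y)" "y \<noteq> 0" "BJ_orth N x y"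
      using supporting_functional_obtain_det2 * f by blast
    obtain z where z: "g = (\<lambda>v. det2 v z)" "z \<noteq> 0" "BJ_orth N x z"
      using supporting_functional_obtain_det2 * g by blast
    have "det2 y z = 0"
      using * y z by blast
    then obtain c where c: "y = c *\<^sub>R z"
      using det2_eq_0_imp_scaleR z by blast
    have "f x = N x" "g x = N x"
      using f g by (simp_all add: supporting_functional_def)
    then have "c * N x = N x"
      using y z c by simp
    then have "c = 1"
      using * by simp
    with c y z show "f = g"
      by simp
  qed
  with ex * show "smooth_vector N x"
    unfolding smooth_vector_def by blast
qed (simp add: smooth_vector_def)

section \<open>Segments on the unit circle and one-dimensional faces\<close>

lemma flat_BJ_orth:
  assumes p: "N (m - d *\<^sub>R y) = 1" "d > 0" and q: "N (m + e *\<^sub>R y) = 1" "e > 0" and m: "N m = 1"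
  shows "BJ_orth N (m + t *\<^sub>R y) y \<longleftrightarrow> N (m + t *\<^sub>R y) = 1"
    and "BJ_orth N m z \<Longrightarrow> z \<noteq> 0 \<Longrightarrow> det2 y z = 0"
proof -
  \<comment> \<open>\<open>N\<close> is convex along the line and equals 1 at \<open>m\<close> and
    at points on both sides of it. A value below 1 would, combined with the point on the other side
    of \<open>m\<close>, give a value below 1 at \<open>m\<close>.\<close>
  have ge: "1 \<le> N (m + c *\<^sub>R y)" for c
  proof -
    have *: "1 \<le> N (m + c *\<^sub>R u)" if u: "N (m - b *\<^sub>R u) = 1" "b > 0" "c > 0" for b c u
    proof -
      have "(b + c) *\<^sub>R m = c *\<^sub>R (m - b *\<^sub>R u) + b *\<^sub>R (m + c *\<^sub>R u)"
        by (simp add: algebra_simps)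
      then have "N ((b + c) *\<^sub>R m) \<le> N (c *\<^sub>R (m - b *\<^sub>R u)) + N (b *\<^sub>R (m + c *\<^sub>R u))"
        using N_triangle by metis
      then have "b + c \<le> c + b * N (m + c *\<^sub>R u)"
        using m u by simp
      then show ?thesis
        using u by simp
    qed
    consider "c = 0" | "c > 0" | "- c > 0"
      by linarith
    then show ?thesis
    proof cases
      case 3
      then show ?thesis
        using *[of e "- y" "- c"] q by simp
    qed (use m *[of d y c] p in auto)
  qed
  show "BJ_orth N (m + t *\<^sub>R y) y \<longleftrightarrow> N (m + t *\<^sub>R y) = 1"
  proof
    assume "BJ_orth N (m + t *\<^sub>R y) y"
    then have "N (m + t *\<^sub>R y) \<le> N (m + t *\<^sub>R y + (- t) *\<^sub>R y)"
      unfolding BJ_orth_def by blast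
    then show "N (m + t *\<^sub>R y) = 1"
      using m ge[of t] by (simp add: add.assoc flip: scaleR_add_left)
  next
    assume *: "N (m + t *\<^sub>R y) = 1"
    show "BJ_orth N (m + t *\<^sub>R y) y"
      unfolding BJ_orth_def * using ge by (simp add: add.assoc flip: scaleR_add_left)
  qed
  assume "BJ_orth N m z" "z \<noteq> 0"
  then have "\<bar>det2 v z\<bar> \<le> N v * \<bar>det2 m z\<bar>" for v
    using m by (simp add: BJ_orth_iff_det2)
  \<comment> \<open>\<open>\<lambda>v. det2 v z\<close> has its largest modulus on the unit circle
    at \<open>m\<close>. Being affine on the segment, it can avoid growing beyond this in either
    direction only if it is constant there.\<close>
  from this[of "m - d *\<^sub>R y"] this[of "m + e *\<^sub>R y"]
  have "\<bar>det2 m z - d * det2 y z\<bar> \<le> \<bar>det2 m z\<bar>" "\<bar>det2 m z + e * det2 y z\<bar> \<le> \<bar>det2 m z\<bar>"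
    using p q by simp_all
  then have "0 \<le> d * det2 y z \<and> e * det2 y z \<le> 0 \<or> d * det2 y z \<le> 0 \<and> 0 \<le> e * det2 y z"
    by linarith
  then show "det2 y z = 0"
    using p(2) q(2) by (auto simp: zero_le_mult_iff mult_le_0_iff)
qed

text \<open>The segment from \<open>a\<close> to a relative interior point \<open>m\<close> can be
  prolonged beyond \<open>m\<close> inside \<open>F\<close>. So \<open>m\<close> is an inner point
  of a segment of the unit circle in direction \<open>a - m\<close>. Taking \<open>a\<close> from
  the closure includes the endpoints of the face.\<close>

lemma rel_interior_BJ_orth:
  assumes F: "convex F" "F \<subseteq> unit_circle" and m: "m \<in> rel_interior F"
    and a: "a \<in> closure F" "a \<noteq> m"
  shows "BJ_orth N m (a - m)" "BJ_orth N a (a - m)"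
    and "BJ_orth N m z \<Longrightarrow> z \<noteq> 0 \<Longrightarrow> det2 (a - m) z = 0"
proof -
  have "m \<in> F"
    using m rel_interior_subset by blast
  then have m1: "N m = 1"
    using F by (auto simp: unit_circle_def)
  have "a \<in> unit_circle"
    using a(1) F(2) closed_unit_circle closure_minimal by blast
  then have a1: "N (m + 1 *\<^sub>R (a - m)) = 1"
    by (simp add: unit_circle_def)
  have "a \<in> affine hull F"
    using a(1) closure_affine_hull by blast
  then obtain e where e: "e > 1" "(1 - e) *\<^sub>R a + e *\<^sub>R m \<in> F"
    using convex_rel_interior_if2[OF F(1) m] by blast
  moreover have "(1 - e) *\<^sub>R a + e *\<^sub>R m = m - (e - 1) *\<^sub>R (a - m)"
    by (simp add: algebra_simps)
  ultimately have p: "N (m - (e - 1) *\<^sub>R (a - m)) = 1" "e - 1 > 0"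
    using F(2) by (auto simp: unit_circle_def)
  note flat = flat_BJ_orth[OF p a1 zero_less_one m1]
  show "BJ_orth N m (a - m)" "BJ_orth N a (a - m)"
    using flat(1)[of 0] flat(1)[of 1] m1 a1 by simp_all
  show "BJ_orth N m z \<Longrightarrow> z \<noteq> 0 \<Longrightarrow> det2 (a - m) z = 0"
    by (rule flat(2))
qed

text \<open>\<open>F\<close> is the set where a functional attains an extremum over the unit circle,
  so it is a face. It lies on one line and contains two distinct points, which gives its
  dimension.\<close>

lemma exposed_unit_ball_face:
  assumes D: "D \<noteq> 0" and y: "\<And>v. \<bar>det2 v y\<bar> \<le> N v * \<bar>D\<bar>"
    and uv: "N u = 1" "det2 u y = D" "N v = 1" "det2 v y = D" "u \<noteq> v"
  defines "F \<equiv> {v. N v = 1 \<and> det2 v y = D}"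
  shows "unit_ball_face N F" "aff_dim F = 1"
proof -
  have "convex F"
    unfolding convex_def F_def
  proof clarify
    fix p q :: "real^2" and s t :: real
    assume pq: "N p = 1" "N q = 1" "D = det2 p y" "det2 q y = det2 p y"
      and st: "0 \<le> s" "0 \<le> t" "s + t = 1"
    let ?w = "s *\<^sub>R p + t *\<^sub>R q"
    have "det2 ?w y = (s + t) * det2 p y"
      using pq by (simp add: algebra_simps)
    then have d: "det2 ?w y = det2 p y"
      using st by simp
    then have "\<bar>D\<bar> \<le> N ?w * \<bar>D\<bar>"
      using y[of ?w] pq by simp
    then have "1 \<le> N ?w"
      using D by simp
    moreover have "N ?w \<le> 1"
      using N_triangle[of "s *\<^sub>R p" "t *\<^sub>R q"] pq st by simp
    ultimately show "N ?w = 1 \<and> det2 ?w y = det2 p y"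
      using d by simp
  qed
  moreover have "p \<in> F \<and> q \<in> F"
    if pq: "N p = 1" "N q = 1" "w \<in> open_segment p q" "w \<in> F" for p q w
  proof -
    obtain t where t: "0 < t" "t < 1" "w = (1 - t) *\<^sub>R p + t *\<^sub>R q"
      using pq(3) unfolding in_segment by blast
    have D_eq: "(1 - t) * det2 p y + t * det2 q y = D"
      using pq(4) t by (simp add: F_def)
    have le: "\<bar>det2 p y\<bar> \<le> \<bar>D\<bar>" "\<bar>det2 q y\<bar> \<le> \<bar>D\<bar>"
      using y[of p] y[of q] pq by simp_all
    \<comment> \<open>The extremum \<open>D\<close> is a maximum or a minimum according to its sign;
      a proper convex combination reaches it only if both terms do.\<close>
    have *: "a = D \<and> b = D"
      if "(1 - t) * a + t * b = D" "a \<le> D \<and> b \<le> D \<or> a \<ge> D \<and> b \<ge> D" for a b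
    proof -
      have "(1 - t) * (D - a) + t * (D - b) = 0"
        using that by (simp add: algebra_simps)
      moreover have "(1 - t) * (D - a) \<ge> 0 \<and> t * (D - b) \<ge> 0 \<or> (1 - t) * (D - a) \<le> 0 \<and> t * (D - b) \<le> 0"
        using that t by (auto simp: mult_le_0_iff)
      ultimately have "(1 - t) * (D - a) = 0 \<and> t * (D - b) = 0"
        by linarith
      then show ?thesis
        using t by simp
    qed
    have "det2 p y = D \<and> det2 q y = D"
      by (rule *[OF D_eq]) (use le in linarith)
    then show ?thesis
      using pq by (simp add: F_def)
  qed
  ultimately show "unit_ball_face N F"
    unfolding unit_ball_face_def by (auto simp: F_def)
  let ?a = "vector [y $ 2, - y $ 1] :: real^2"
  have det: "det2 v y = ?a \<bullet> v" for v
    by (simp add: det2_def inner_vec_def sum_2 mult.commute)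
  have "?a \<noteq> 0"
    using det[of u] uv D by auto
  then have "aff_dim {v. ?a \<bullet> v = D} = 1"
    using aff_dim_hyperplane[of ?a D] by simp
  moreover have "F \<subseteq> {v. ?a \<bullet> v = D}"
    by (auto simp: F_def det)
  ultimately have "aff_dim F \<le> 1"
    using aff_dim_subset by metis
  moreover have "aff_dim {u, v} \<le> aff_dim F"
    using uv by (intro aff_dim_subset) (auto simp: F_def)
  ultimately show "aff_dim F = 1"
    using uv(5) by simp
qed

end

section \<open>Radon planes\<close>

text \<open>The vertex 0 is adjacent to every vertex, itself included. Without it the graph has no
  loops.\<close>

definition bj_adj :: "(real^2 \<Rightarrow> real) \<Rightarrow> real^2 \<Rightarrow> real^2 \<Rightarrow> bool" where
  "bj_adj N x y \<longleftrightarrow> x \<noteq> 0 \<and> y \<noteq> 0 \<and> BJ_orth N x y"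

definition bj_path_closed :: "(real^2 \<Rightarrow> real) \<Rightarrow> bool" where
  "bj_path_closed N \<longleftrightarrow>
     (\<forall>x y z w. bj_adj N x y \<longrightarrow> bj_adj N y z \<longrightarrow> bj_adj N z w \<longrightarrow> bj_adj N x w)"

locale radon = normed_plane +
  assumes BJ_orth_sym: "BJ_orth N x y \<Longrightarrow> BJ_orth N y x"
begin

text \<open>With \<open>m\<close> in the relative interior, any \<open>z\<close> orthogonal to
  \<open>a\<close> prolongs the path from \<open>m\<close> through \<open>a - m\<close> to
  \<open>a\<close>. Closing it makes \<open>z\<close> a neighbour of \<open>m\<close>, and
  \<open>m\<close> has only multiples of \<open>a - m\<close> as neighbours.\<close>

lemma bj_path_closed_imp_smooth:
  assumes closed: "bj_path_closed N" and F: "unit_ball_face N F" and a: "a \<in> rel_frontier F"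
  shows "smooth_vector N a"
proof -
  have F1: "convex F" "F \<subseteq> unit_circle"
    using F by (auto simp: unit_ball_face_def unit_circle_def)
  have acl: "a \<in> closure F" "a \<notin> rel_interior F"
    using a by (auto simp: rel_frontier_def)
  then have "F \<noteq> {}"
    by auto
  then obtain m where m: "m \<in> rel_interior F"
    using rel_interior_eq_empty[OF F1(1)] by blast
  then have "a \<noteq> m"
    using acl by blast
  note flat = rel_interior_BJ_orth[OF F1 m acl(1) this]
  have circle: "m \<in> unit_circle" "a \<in> unit_circle"
    using m rel_interior_subset[of F] acl(1) F1(2) closed_unit_circle closure_minimal by blast+
  then have nz: "m \<noteq> 0" "a \<noteq> 0" "a - m \<noteq> 0"
    using \<open>a \<noteq> m\<close> by (auto simp: unit_circle_def)
  have "det2 (a - m) z = 0" if "z \<noteq> 0" "BJ_orth N a z" for z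
  proof -
    have "bj_adj N m (a - m)" "bj_adj N (a - m) a" "bj_adj N a z"
      using flat(1,2) nz that BJ_orth_sym by (auto simp: bj_adj_def)
    then have "bj_adj N m z"
      using closed unfolding bj_path_closed_def by blast
    then show ?thesis
      using flat(3) by (simp add: bj_adj_def)
  qed
  then show ?thesis
    unfolding smooth_vector_iff using nz det2_0_trans det2_commute by (metis neg_0_equal_iff_equal)
qed

text \<open>If \<open>x\<close> and \<open>z\<close> are not parallel, their common neighbour
  \<open>y\<close> gives a face through multiples of both. The one of \<open>z\<close> is relatively
  interior or a smooth endpoint, so \<open>w\<close> is parallel to \<open>y\<close>.\<close>

lemma smooth_imp_bj_path_closed:
  assumes "\<And>F a. unit_ball_face N F \<Longrightarrow> aff_dim F = 1 \<Longrightarrow> a \<in> rel_frontier F \<Longrightarrow> smooth_vector N a"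
  shows "bj_path_closed N"
  unfolding bj_path_closed_def
proof (intro allI impI)
  fix x y z w
  assume "bj_adj N x y" "bj_adj N y z" "bj_adj N z w"
  then have nz: "x \<noteq> 0" "y \<noteq> 0" "z \<noteq> 0" "w \<noteq> 0"
    and xy: "BJ_orth N x y" and zy: "BJ_orth N z y" and zw: "BJ_orth N z w"
    using BJ_orth_sym by (auto simp: bj_adj_def)
  have "BJ_orth N x w"
  proof (cases "det2 x z = 0")
    case True
    then obtain c where "x = c *\<^sub>R z"
      using det2_eq_0_imp_scaleR nz by blast
    then show ?thesis
      using BJ_orth_scaleR[OF zw, of c 1] by simp
  next
    case False
    define u where "u = x /\<^sub>R N x"
    define D where "D = det2 u y"
    \<comment> \<open>The sign selects, of the two opposite faces parallel to \<open>y\<close>, the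
      one containing \<open>u\<close>.\<close>
    define s :: real where "s = (if det2 (z /\<^sub>R N z) y = D then 1 else - 1)"
    define v where "v = s *\<^sub>R (z /\<^sub>R N z)"
    have s: "s \<noteq> 0" "\<bar>s\<bar> = 1"
      by (auto simp: s_def)
    have Nu: "N u = 1" "N v = 1"
      using nz s by (simp_all add: u_def v_def abs_mult)
    have uy: "BJ_orth N u y"
      using BJ_orth_scaleR[OF xy, of "inverse (N x)" 1] by (simp add: u_def)
    have v: "BJ_orth N v b" if "BJ_orth N z b" for b
      using BJ_orth_scaleR[OF that, of "s / N z" 1] by (simp add: v_def divide_inverse)
    have "D \<noteq> 0"
      using BJ_orth_det2_nonzero[OF uy] nz by (simp add: D_def u_def)
    have le: "\<bar>det2 b y\<bar> \<le> N b * \<bar>D\<bar>" for b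
      using uy nz Nu by (simp add: BJ_orth_iff_det2 D_def)
    have zN: "BJ_orth N (z /\<^sub>R N z) y" "N (z /\<^sub>R N z) = 1"
      using BJ_orth_scaleR[OF zy, of "inverse (N z)" 1] nz by simp_all
    \<comment> \<open>Both normalized vectors maximize the modulus of
      \<open>\<lambda>b. det2 b y\<close> on the unit circle, so the values agree up to
      sign.\<close>
    then have "\<bar>D\<bar> \<le> \<bar>det2 (z /\<^sub>R N z) y\<bar>" "\<bar>det2 (z /\<^sub>R N z) y\<bar> \<le> \<bar>D\<bar>"
      using nz Nu le[of "z /\<^sub>R N z"] unfolding BJ_orth_iff_det2[OF nz(2)] D_def
      by (metis mult_1)+
    then have "\<bar>det2 (z /\<^sub>R N z) y\<bar> = \<bar>D\<bar>"
      by linarith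
    moreover have "det2 v y = s * det2 (z /\<^sub>R N z) y"
      by (simp only: v_def det2_scaleR(1))
    ultimately have vD: "det2 v y = D"
      by (auto simp: s_def abs_eq_iff simp del: det2_scaleR)
    have "u \<noteq> v"
    proof
      assume "u = v"
      then have "det2 u z = 0"
        by (simp add: v_def)
      then show False
        using False nz by (simp add: u_def)
    qed
    define F where "F = {v. N v = 1 \<and> det2 v y = D}"
    have F: "unit_ball_face N F" "aff_dim F = 1"
      using exposed_unit_ball_face[OF \<open>D \<noteq> 0\<close> le Nu(1) _ Nu(2) vD \<open>u \<noteq> v\<close>]
      by (simp_all add: F_def D_def)
    have mem: "u \<in> F" "v \<in> F"
      using Nu vD by (auto simp: F_def D_def)
    have "det2 y w = 0"
    proof (cases "v \<in> rel_interior F")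
      case True
      have F1: "convex F" "F \<subseteq> unit_circle"
        using F by (auto simp: unit_ball_face_def unit_circle_def)
      have *: "det2 (u - v) b = 0" if "b \<noteq> 0" "BJ_orth N v b" for b
        using rel_interior_BJ_orth(3)[OF F1 True] closure_subset mem \<open>u \<noteq> v\<close> that by blast
      have "det2 (u - v) w = 0" "det2 (u - v) y = 0"
        using * v zy zw nz by blast+
      then show ?thesis
        using det2_0_trans[of y "u - v" w] det2_commute[of y "u - v"] \<open>u \<noteq> v\<close> by simp
    next
      case False
      then have "smooth_vector N v"
        using assms[OF F] mem closure_subset unfolding rel_frontier_def by blast
      then show ?thesis
        using v zy zw nz unfolding smooth_vector_iff by blast
    qed
    then obtain c where "w = c *\<^sub>R y"
      using det2_eq_0_imp_scaleR[of w y] nz det2_commute[of w y] by auto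
    then show ?thesis
      using BJ_orth_scaleR[OF xy, of 1 c] by simp
  qed
  then show "bj_adj N x w"
    using nz by (simp add: bj_adj_def)
qed

section \<open>Counting neighbours and components\<close>

lemma biclique_graph_bj_adj:
  assumes "bj_path_closed N"
  shows "biclique_graph (bj_adj N) (- {0})"
proof
  show "\<exists>y. bj_adj N x y" if "x \<in> - {0}" for x
    using BJ_orth_exists[of x] that by (auto simp: bj_adj_def)
  show "bj_adj N x w" if "bj_adj N x y" "bj_adj N y z" "bj_adj N z w" for x y z w
    using assms that unfolding bj_path_closed_def by blast
qed (auto simp: bj_adj_def BJ_orth_self_iff BJ_orth_sym)

lemma nbr_eqpoll_reals:
  assumes "x \<noteq> 0"
  shows "Collect (bj_adj N x) \<approx> (UNIV :: real set)"
proof (rule lepoll_antisym[OF real2_lepoll_reals])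
  obtain y where y: "y \<noteq> 0" "BJ_orth N x y"
    using BJ_orth_exists by blast
  have "(UNIV :: real set) \<approx> {0<..<1::real}"
    using open_interval_eqpoll_reals[of 0 1] eqpoll_sym by auto
  \<comment> \<open>Scalars from this interval are nonzero, so they yield distinct neighbours on the
    ray of \<open>y\<close>.\<close>
  moreover have "{0<..<1::real} \<lesssim> Collect (bj_adj N x)"
    unfolding lepoll_def
  proof (intro exI[of _ "\<lambda>r. r *\<^sub>R y"] conjI)
    show "(\<lambda>r. r *\<^sub>R y) ` {0<..<1} \<subseteq> Collect (bj_adj N x)"
      using y assms BJ_orth_scaleR[of x y 1] by (auto simp: bj_adj_def)
  qed (use y in \<open>auto simp: inj_on_def\<close>)
  ultimately show "(UNIV :: real set) \<lesssim> Collect (bj_adj N x)"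
    by (rule lepoll_trans1)
qed

text \<open>Orthogonality is a closed relation, and projecting a closed set along a compact factor
  preserves closedness.\<close>

lemma compact_nbr:
  assumes "compact C"
  shows "compact {y \<in> unit_circle. \<exists>x\<in>C. BJ_orth N x y}"
proof -
  have "{p :: (real^2) \<times> (real^2). BJ_orth N (fst p) (snd p)} =
    (\<Inter>c. {p. N (fst p) \<le> N (fst p + c *\<^sub>R snd p)})"
    by (auto simp: BJ_orth_def)
  moreover have "closed \<dots>"
    by (intro closed_INT ballI closed_Collect_le continuous_intros)
  ultimately have "closed {p :: (real^2) \<times> (real^2). BJ_orth N (fst p) (snd p)}"
    by simp
  from closed_compact_projection[OF assms this]
  have "closed {y. \<exists>x. x \<in> C \<and> BJ_orth N x y}"
    by simp
  then have "compact (unit_circle \<inter> {y. \<exists>x. x \<in> C \<and> BJ_orth N x y})"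
    using compact_unit_circle by (rule compact_Int_closed[rotated])
  moreover have "unit_circle \<inter> {y. \<exists>x. x \<in> C \<and> BJ_orth N x y} = {y \<in> unit_circle. \<exists>x\<in>C. BJ_orth N x y}"
    by blast
  ultimately show ?thesis
    by simp
qed

lemma comps_eqpoll_reals:
  assumes "bj_path_closed N"
  shows "biclique_graph.comp (bj_adj N) ` (- {0}) \<approx> (UNIV :: real set)"
proof (rule lepoll_antisym)
  interpret G: biclique_graph "bj_adj N" "- {0}"
    using biclique_graph_bj_adj[OF assms] .
  show "G.comp ` (- {0}) \<lesssim> (UNIV :: real set)"
    using image_lepoll real2_lepoll_reals lepoll_trans by metis
  have nz: "x \<noteq> 0" if "x \<in> unit_circle" for x
    using that by (auto simp: unit_circle_def)
  have adj: "bj_adj N x y \<longleftrightarrow> BJ_orth N x y" if "x \<in> unit_circle" "y \<in> unit_circle" for x y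
    using that nz by (auto simp: bj_adj_def)
  \<comment> \<open>Intermediate vertices of paths can be normalized, so components can be traced on
    the unit circle alone.\<close>
  have unit_nbr: "\<exists>y\<in>unit_circle. bj_adj N x y \<and> bj_adj N y z" if yz: "bj_adj N x y" "bj_adj N y z" for x y z
  proof (intro bexI[of _ "y /\<^sub>R N y"] conjI)
    show "bj_adj N x (y /\<^sub>R N y)"
      using yz BJ_orth_scaleR[of x y 1] by (auto simp: bj_adj_def)
    show "bj_adj N (y /\<^sub>R N y) z"
      using yz BJ_orth_scaleR[of y z _ 1] by (auto simp: bj_adj_def)
    have "y \<noteq> 0"
      using yz by (simp add: bj_adj_def)
    then show "y /\<^sub>R N y \<in> unit_circle"
      using left_inverse[of "N y"] by (simp add: unit_circle_def)
  qed
  have "(UNIV :: real set) \<lesssim> G.comp ` unit_circle"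
  proof -
    \<comment> \<open>The saturation of \<open>C\<close> consists of the neighbours and second
      neighbours of \<open>C\<close> on the circle; applying \<open>compact_nbr\<close> once and
      twice shows that it is closed.\<close>
    let ?nbr = "\<lambda>C. {y \<in> unit_circle. \<exists>x\<in>C. BJ_orth N x y}"
    have sat: "closed {x \<in> unit_circle. G.comp x \<in> G.comp ` C}" if C: "closed C" "C \<subseteq> unit_circle" for C
    proof -
      have comp_iff: "z \<in> G.comp x \<longleftrightarrow> z \<in> ?nbr {x} \<union> ?nbr (?nbr {x})"
        if "x \<in> unit_circle" "z \<in> unit_circle" for x z
      proof -
        have "z \<in> G.comp x \<longleftrightarrow> bj_adj N x z \<or> (\<exists>y\<in>unit_circle. bj_adj N x y \<and> bj_adj N y z)"
          unfolding G.comp_def G.side_def using unit_nbr[of x _ z] by auto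
        then show ?thesis
          using that adj by auto
      qed
      have sat_iff: "G.comp z \<in> G.comp ` C \<longleftrightarrow> (\<exists>x\<in>C. z \<in> G.comp x)" if "z \<in> unit_circle" for z
      proof -
        have "G.comp z = G.comp x \<longleftrightarrow> z \<in> G.comp x" if "x \<in> C" for x
          using that C(2) nz \<open>z \<in> unit_circle\<close> G.comp_eq_iff[of x z] by auto
        then show ?thesis
          by (auto simp: image_iff)
      qed
      have "{z \<in> unit_circle. G.comp z \<in> G.comp ` C} =
        {z \<in> unit_circle. \<exists>x\<in>C. z \<in> ?nbr {x} \<union> ?nbr (?nbr {x})}"
      proof (intro Collect_cong conj_cong refl)
        fix z assume z: "z \<in> unit_circle"
        show "G.comp z \<in> G.comp ` C \<longleftrightarrow> (\<exists>x\<in>C. z \<in> ?nbr {x} \<union> ?nbr (?nbr {x}))"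
          unfolding sat_iff[OF z] by (intro bex_cong refl comp_iff z) (use C(2) in blast)
      qed
      also have "\<dots> = ?nbr C \<union> ?nbr (?nbr C)"
        by auto
      finally have "{x \<in> unit_circle. G.comp x \<in> G.comp ` C} = ?nbr C \<union> ?nbr (?nbr C)" .
      moreover have "compact C"
        using C compact_unit_circle by (metis closed_Int_compact inf.orderE)
      ultimately show ?thesis
        by (simp only: closed_Un compact_imp_closed compact_nbr)
    qed
    obtain x where x: "x \<in> unit_circle"
    proof -
      obtain u :: "real^2" where "u \<noteq> 0"
        using BJ_orth_exists by blast
      then have "u /\<^sub>R N u \<in> unit_circle"
        using left_inverse[of "N u"] by (simp add: unit_circle_def)
      then show ?thesis
        by (rule that)
    qed
    have "\<exists>y\<in>unit_circle. G.comp x \<noteq> G.comp y"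
    proof (rule ccontr)
      assume "\<not> ?thesis"
      \<comment> \<open>If there were a single component, its two parts would split the connected
        unit circle into two disjoint nonempty closed sets.\<close>
      then have all: "unit_circle \<subseteq> G.comp x"
        using G.comp_eq_iff nz x by blast
      obtain y where y: "y \<in> unit_circle" "bj_adj N x y"
        using G.nbr_ex[of x] nz[OF x] unit_nbr G.sym by blast
      let ?A = "?nbr {x}" and ?B = "?nbr {y}"
      have "closed ?A" "closed ?B"
        by (simp_all only: compact_imp_closed compact_nbr compact_sing)
      moreover have "unit_circle \<subseteq> ?A \<union> ?B"
      proof
        fix z assume z: "z \<in> unit_circle"
        then have "bj_adj N x z \<or> z \<in> G.side x"
          using all unfolding G.comp_def by blast
        then show "z \<in> ?A \<union> ?B"
          using G.side_eq_nbr[OF G.sym[OF y(2)]] z x y adj by auto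
      qed
      moreover have "?A \<inter> ?B \<inter> unit_circle = {}"
      proof -
        have "\<not> (bj_adj N x z \<and> bj_adj N y z)" for z
          using y(2) G.path3 G.sym G.irrefl by blast
        then show ?thesis
          using x y adj by auto
      qed
      moreover have "y \<in> ?A" "x \<in> ?B"
        using x y adj BJ_orth_sym by auto
      ultimately show False
        using connected_closedD[OF connected_unit_circle, of ?A ?B] x y by blast
    qed
    then show ?thesis
      using continuum_quotient_reals_lepoll[OF compact_unit_circle connected_unit_circle sat x] by blast
  qed
  also have "G.comp ` unit_circle \<lesssim> G.comp ` (- {0})"
    using nz by (intro subset_imp_lepoll image_mono) blast
  finally show "(UNIV :: real set) \<lesssim> G.comp ` (- {0})" .
qed

lemma bj_adj_model:
  assumes "bj_path_closed N"
  obtains \<phi> :: "real^2 \<Rightarrow> real \<times> bool \<times> real"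
  where "bij_betw \<phi> (- {0}) UNIV"
    and "\<And>x y. x \<noteq> 0 \<Longrightarrow> y \<noteq> 0 \<Longrightarrow>
      BJ_orth N x y \<longleftrightarrow> fst (\<phi> x) = fst (\<phi> y) \<and> fst (snd (\<phi> x)) \<noteq> fst (snd (\<phi> y))"
proof -
  interpret G: biclique_graph "bj_adj N" "- {0}"
    using biclique_graph_bj_adj[OF assms] .
  show ?thesis
  proof (rule G.biclique_model)
    fix \<phi> :: "real^2 \<Rightarrow> real \<times> bool \<times> real"
    assume bij: "bij_betw \<phi> (- {0}) UNIV"
      and "\<And>x y. x \<in> - {0} \<Longrightarrow> y \<in> - {0} \<Longrightarrow>
        bj_adj N x y \<longleftrightarrow> fst (\<phi> x) = fst (\<phi> y) \<and> fst (snd (\<phi> x)) \<noteq> fst (snd (\<phi> y))"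
    then show thesis
      by (intro that[OF bij]) (simp add: bj_adj_def)
  qed (use nbr_eqpoll_reals comps_eqpoll_reals[OF assms] in auto)
qed

end

section \<open>Isomorphisms between graphs of Radon planes\<close>

lemma radon_isomorphic:
  assumes N: "radon N" "bj_path_closed N" and M: "radon M" "bj_path_closed M"
  shows "\<exists>\<phi>. bij \<phi> \<and> (\<forall>x y. BJ_orth N x y \<longleftrightarrow> BJ_orth M (\<phi> x) (\<phi> y))"
proof -
  interpret N: radon N by fact
  interpret M: radon M by fact
  obtain f where f: "bij_betw f (- {0}) (UNIV :: (real \<times> bool \<times> real) set)"
    "\<And>x y. x \<noteq> 0 \<Longrightarrow> y \<noteq> 0 \<Longrightarrow>
      BJ_orth N x y \<longleftrightarrow> fst (f x) = fst (f y) \<and> fst (snd (f x)) \<noteq> fst (snd (f y))"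
    using N.bj_adj_model[OF N(2)] by blast
  obtain g where g: "bij_betw g (- {0}) (UNIV :: (real \<times> bool \<times> real) set)"
    "\<And>x y. x \<noteq> 0 \<Longrightarrow> y \<noteq> 0 \<Longrightarrow>
      BJ_orth M x y \<longleftrightarrow> fst (g x) = fst (g y) \<and> fst (snd (g x)) \<noteq> fst (snd (g y))"
    using M.bj_adj_model[OF M(2)] by blast
  define h where "h = inv_into (- {0}) g \<circ> f"
  have h: "bij_betw h (- {0}) (- {0})"
    unfolding h_def using bij_betw_trans[OF f(1) bij_betw_inv_into[OF g(1)]] .
  have gh: "g (h x) = f x" for x
    using bij_betw_inv_into_right[OF g(1)] by (simp add: h_def)
  \<comment> \<open>The coordinates cover only nonzero vectors; 0, adjacent to everything in both
    graphs, is matched with 0.\<close>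
  define \<phi> where "\<phi> = h(0 := 0)"
  have "bij_betw \<phi> (- {0}) (- {0})"
    using h by (simp add: \<phi>_def bij_betw_def inj_on_fun_updI image_def)
  moreover have "bij_betw \<phi> {0} {0}"
    by (simp add: \<phi>_def bij_betw_def)
  ultimately have "bij_betw \<phi> (- {0} \<union> {0}) (- {0} \<union> {0})"
    by (rule bij_betw_combine) auto
  then have "bij \<phi>"
    by (simp add: Un_commute)
  moreover have "BJ_orth N x y \<longleftrightarrow> BJ_orth M (\<phi> x) (\<phi> y)" for x y
  proof (cases "x = 0 \<or> y = 0")
    case True
    then show ?thesis
      by (auto simp: \<phi>_def BJ_orth_def)
  next
    case False
    then have "h x \<noteq> 0" "h y \<noteq> 0"
      using bij_betwE[OF h] by auto
    then show ?thesis
      using f(2)[of x y] g(2)[of "h x" "h y"] gh False by (simp add: \<phi>_def)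
  qed
  ultimately show ?thesis
    by blast
qed

lemma isomorphic_bj_path_closed:
  assumes "radon N" "radon M" "bj_path_closed M"
    and "bij \<phi>" and \<phi>: "\<And>x y. BJ_orth N x y \<longleftrightarrow> BJ_orth M (\<phi> x) (\<phi> y)"
  shows "bj_path_closed N"
proof -
  interpret N: radon N by fact
  interpret M: radon M by fact
  have "x = 0 \<longleftrightarrow> \<phi> x = 0" for x
    using \<phi>[of x x] by (simp add: N.BJ_orth_self_iff M.BJ_orth_self_iff)
  then have "bj_adj N x y \<longleftrightarrow> bj_adj M (\<phi> x) (\<phi> y)" for x y
    using \<phi> unfolding bj_adj_def by blast
  then show ?thesis
    using assms(3) unfolding bj_path_closed_def by blast
qed

section \<open>The Euclidean plane\<close>

lemma BJ_orth_norm_iff: "BJ_orth norm x y \<longleftrightarrow> x \<bullet> y = 0" for x y :: "'a::real_inner"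
proof
  assume xy: "BJ_orth norm x y"
  show "x \<bullet> y = 0"
  proof (cases "y = 0")
    case False
    \<comment> \<open>This \<open>c\<close> minimizes the norm of \<open>x + c *\<^sub>R y\<close>:
      it leads to the foot of the perpendicular from the origin.\<close>
    define c where "c = - (x \<bullet> y) / (y \<bullet> y)"
    have "(norm x)\<^sup>2 \<le> (norm (x + c *\<^sub>R y))\<^sup>2"
      using xy unfolding BJ_orth_def by (simp add: power_mono)
    also have "\<dots> = (norm x)\<^sup>2 + 2 * c * (x \<bullet> y) + c * (c * (y \<bullet> y))"
      by (simp add: power2_norm_eq_inner inner_add_left inner_add_right inner_commute algebra_simps)
    also have "c * (y \<bullet> y) = - (x \<bullet> y)"
      using False by (simp add: c_def)
    finally have "0 \<le> c * (x \<bullet> y)"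
      by simp
    then have "0 \<le> - (x \<bullet> y)\<^sup>2 / (y \<bullet> y)"
      by (simp add: c_def power2_eq_square)
    moreover have "0 < y \<bullet> y"
      using False by simp
    ultimately show ?thesis
      by (simp add: divide_le_0_iff)
  qed simp
next
  assume "x \<bullet> y = 0"
  then have "(norm x)\<^sup>2 \<le> (norm (x + c *\<^sub>R y))\<^sup>2" for c
    using mult_nonneg_nonneg[OF zero_le_square[of c] inner_ge_zero[of y]]
    by (simp add: power2_norm_eq_inner inner_add_left inner_add_right inner_commute mult.assoc)
  then show "BJ_orth norm x y"
    unfolding BJ_orth_def using power2_le_imp_le by fastforce
qed

lemma radon_norm: "radon norm"
proof
  show "is_norm (norm :: real^2 \<Rightarrow> real)"
    by (auto simp: is_norm_def norm_triangle_ineq)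
qed (simp add: BJ_orth_norm_iff inner_commute)

lemma bj_path_closed_norm: "bj_path_closed norm"
  unfolding bj_path_closed_def
proof (intro allI impI)
  fix x y z w :: "real^2"
  assume *: "bj_adj norm x y" "bj_adj norm y z" "bj_adj norm z w"
  then have nz: "x \<noteq> 0" "y \<noteq> 0" "z \<noteq> 0" "w \<noteq> 0" and o: "x \<bullet> y = 0" "z \<bullet> y = 0" "z \<bullet> w = 0"
    by (auto simp: bj_adj_def BJ_orth_norm_iff inner_commute)
  \<comment> \<open>Cramer's rule for recovering \<open>y\<close> from its inner products with
    \<open>x\<close> and \<open>z\<close>: if both vanish and \<open>y\<close> is nonzero, then
    \<open>x\<close> and \<open>z\<close> are parallel.\<close>
  have "det2 x z *\<^sub>R y = (z \<bullet> y) *\<^sub>R vector [- x $ 2, x $ 1] - (x \<bullet> y) *\<^sub>R vector [- z $ 2, z $ 1]"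
    by (simp add: vec_eq_iff forall_2 det2_def inner_vec_def sum_2 algebra_simps)
  then have "det2 x z = 0"
    using o nz by simp
  then obtain c where "x = c *\<^sub>R z"
    using det2_eq_0_imp_scaleR nz by blast
  then show "bj_adj norm x w"
    using o nz by (simp add: bj_adj_def BJ_orth_norm_iff)
qed

theorem lemma3p11:
  fixes N :: "real^2 \<Rightarrow> real"
  assumes "radon_plane N"
  shows "digraph_iso (with_proj (Gamma0 N)) (with_proj (Gamma0 (norm :: real^2 \<Rightarrow> real)))
    \<longleftrightarrow> (\<forall>F. unit_ball_face N F \<and> aff_dim F = 1 \<longrightarrow> (\<forall>x\<in>rel_frontier F. smooth_vector N x))"
proof -
  have N: "radon N"
    using assms unfolding radon_plane_def by unfold_locales (auto dest: sympD)
  have "digraph_iso (with_proj (Gamma0 N)) (with_proj (Gamma0 (norm :: real^2 \<Rightarrow> real)))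
    \<longleftrightarrow> bj_path_closed N"
    unfolding digraph_iso_Gamma0
    using radon_isomorphic[OF N _ radon_norm bj_path_closed_norm]
      isomorphic_bj_path_closed[OF N radon_norm bj_path_closed_norm] by blast
  also have "\<dots> \<longleftrightarrow>
    (\<forall>F. unit_ball_face N F \<and> aff_dim F = 1 \<longrightarrow> (\<forall>x\<in>rel_frontier F. smooth_vector N x))"
    using radon.bj_path_closed_imp_smooth[OF N] radon.smooth_imp_bj_path_closed[OF N] by blast
  finally show ?thesis .
qed

end
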